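(* Let $\{N(t_1,t_2),\ (t_1,t_2)\in\mathbb{R}^2_+\}$ be the Poisson random field with rate $1$ and let $Z_1,Z_2,\dots$ be iid standard normal random variables independent of it. For $n\ge1$ let $$\mathscr{X}_n(t_1,t_2)=n^{-1}\sum_{j=1}^{N(nt_1,nt_2)}Z_j .$$ Then, for each fixed $(t_1,t_2)\in\mathbb{R}^2_+$, the sequence $\{\mathscr{X}_n(t_1,t_2)\}_{n\ge1}$ converges in distribution, as $n\to\infty$, to $W(t_1,t_2)$, where $\{W(t_1,t_2),\ (t_1,t_2)\in\mathbb{R}^2_+\}$ is the two parameter Brownian sheet.
   Context: $\mathbb{R}_+=[0,\infty)$. An empty sum is $0$. For a two parameter process $X$, the increment over $(s_1,t_1]\times(s_2,t_2]$ is $X(t_1,t_2)-X(s_1,t_2)-X(t_1,s_2)+X(s_1,s_2)$. Poisson random field with rate $\lambda$: a field $\{N(t_1,t_2)\}$ on $\mathbb{R}_+^2$ with $N(0,t_2)=N(t_1,0)=0$ a.s., whose increment over $(s_1,t_1]\times(s_2,t_2]$ is Poisson with mean $\lambda(t_1-s_1)(t_2-s_2)$, and whose increments over disjoint rectangles are independent. Brownian sheet: a process $\{W(t_1,t_2)\}$ with $W(0,t_2)=W(t_1,0)=0$ a.s., with independent and stationary rectangular increments, the increment over $(s_1,t_1]\times(s_2,t_2]$ being normal with mean zero and variance $(t_1-s_1)(t_2-s_2)$. *)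

theory Defs
  imports "HOL-Probability.Probability"
begin

text \<open>
  A quadruple \<open>(s\<^sub>1, t\<^sub>1, s\<^sub>2, t\<^sub>2)\<close> encodes the rectangle \<open>(s\<^sub>1, t\<^sub>1] \<times> (s\<^sub>2, t\<^sub>2]\<close>. Only nonempty
  rectangles are admitted: the increment over an empty one is identically 0, and the
  library's \<open>poisson_pmf\<close> and \<open>normal_density\<close> are meaningful only for positive parameters.
\<close>

type_synonym rectangle = "real \<times> real \<times> real \<times> real"

definition rectangles :: "rectangle set" where
  "rectangles = {(s\<^sub>1, t\<^sub>1, s\<^sub>2, t\<^sub>2). 0 \<le> s\<^sub>1 \<and> s\<^sub>1 < t\<^sub>1 \<and> 0 \<le> s\<^sub>2 \<and> s\<^sub>2 < t\<^sub>2}"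

fun rect :: "rectangle \<Rightarrow> (real \<times> real) set" where
  "rect (s\<^sub>1, t\<^sub>1, s\<^sub>2, t\<^sub>2) = {s\<^sub>1<..t\<^sub>1} \<times> {s\<^sub>2<..t\<^sub>2}"

fun rect_area :: "rectangle \<Rightarrow> real" where
  "rect_area (s\<^sub>1, t\<^sub>1, s\<^sub>2, t\<^sub>2) = (t\<^sub>1 - s\<^sub>1) * (t\<^sub>2 - s\<^sub>2)"

fun rect_shift :: "real \<Rightarrow> real \<Rightarrow> rectangle \<Rightarrow> rectangle" where
  "rect_shift h\<^sub>1 h\<^sub>2 (s\<^sub>1, t\<^sub>1, s\<^sub>2, t\<^sub>2) = (s\<^sub>1 + h\<^sub>1, t\<^sub>1 + h\<^sub>1, s\<^sub>2 + h\<^sub>2, t\<^sub>2 + h\<^sub>2)"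

fun rect_increment :: "(real \<Rightarrow> real \<Rightarrow> 'a \<Rightarrow> real) \<Rightarrow> rectangle \<Rightarrow> 'a \<Rightarrow> real" where
  "rect_increment X (s\<^sub>1, t\<^sub>1, s\<^sub>2, t\<^sub>2) \<omega> = X t\<^sub>1 t\<^sub>2 \<omega> - X s\<^sub>1 t\<^sub>2 \<omega> - X t\<^sub>1 s\<^sub>2 \<omega> + X s\<^sub>1 s\<^sub>2 \<omega>"

context prob_space
begin

definition indep_rect_increments :: "(real \<Rightarrow> real \<Rightarrow> 'a \<Rightarrow> real) \<Rightarrow> bool" where
  "indep_rect_increments X \<longleftrightarrow>
     (\<forall>R \<subseteq> rectangles. finite R \<longrightarrow> disjoint_family_on rect R \<longrightarrow>
        indep_vars (\<lambda>_. borel) (rect_increment X) R)"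

definition stationary_rect_increments :: "(real \<Rightarrow> real \<Rightarrow> 'a \<Rightarrow> real) \<Rightarrow> bool" where
  "stationary_rect_increments X \<longleftrightarrow>
     (\<forall>r \<in> rectangles. \<forall>h\<^sub>1 \<ge> 0. \<forall>h\<^sub>2 \<ge> 0.
        distr M borel (rect_increment X (rect_shift h\<^sub>1 h\<^sub>2 r)) = distr M borel (rect_increment X r))"

text \<open>
  Processes on \<open>\<real>\<^sub>+\<^sup>2\<close> are functions on \<open>\<real>\<^sup>2\<close>, unconstrained outside the quadrant. The Poisson
  field takes values in \<^typ>\<open>nat\<close>; its increments are formed in \<^typ>\<open>real\<close>, where subtraction
  does not truncate.
\<close>

definition poisson_random_field :: "real \<Rightarrow> (real \<Rightarrow> real \<Rightarrow> 'a \<Rightarrow> nat) \<Rightarrow> bool" where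
  "poisson_random_field rate N \<longleftrightarrow>
     0 < rate \<and>
     (\<forall>t\<^sub>1 \<ge> 0. \<forall>t\<^sub>2 \<ge> 0. random_variable (count_space UNIV) (N t\<^sub>1 t\<^sub>2)) \<and>
     (\<forall>t \<ge> 0. AE \<omega> in M. N 0 t \<omega> = 0) \<and>
     (\<forall>t \<ge> 0. AE \<omega> in M. N t 0 \<omega> = 0) \<and>
     (\<forall>r \<in> rectangles.
        distr M borel (rect_increment (\<lambda>t\<^sub>1 t\<^sub>2 \<omega>. real (N t\<^sub>1 t\<^sub>2 \<omega>)) r) =
        distr (measure_pmf (poisson_pmf (rate * rect_area r))) borel real) \<and>
     indep_rect_increments (\<lambda>t\<^sub>1 t\<^sub>2 \<omega>. real (N t\<^sub>1 t\<^sub>2 \<omega>))"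

definition brownian_sheet :: "(real \<Rightarrow> real \<Rightarrow> 'a \<Rightarrow> real) \<Rightarrow> bool" where
  "brownian_sheet W \<longleftrightarrow>
     (\<forall>t\<^sub>1 \<ge> 0. \<forall>t\<^sub>2 \<ge> 0. random_variable borel (W t\<^sub>1 t\<^sub>2)) \<and>
     (\<forall>t \<ge> 0. AE \<omega> in M. W 0 t \<omega> = 0) \<and>
     (\<forall>t \<ge> 0. AE \<omega> in M. W t 0 \<omega> = 0) \<and>
     indep_rect_increments W \<and>
     stationary_rect_increments W \<and>
     (\<forall>r \<in> rectangles.
        distributed M lborel (rect_increment W r) (normal_density 0 (sqrt (rect_area r))))"

text \<open>
  Independence of the whole field and the whole sequence: the sigma-algebras they generate, as
  random elements of product spaces, are independent. The library's \<open>indep_var\<close> would force both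
  to take values in the same type.
\<close>

definition field_indep_of_seq :: "(real \<Rightarrow> real \<Rightarrow> 'a \<Rightarrow> nat) \<Rightarrow> (nat \<Rightarrow> 'a \<Rightarrow> real) \<Rightarrow> bool" where
  "field_indep_of_seq N Z \<longleftrightarrow>
     indep_set
       (sets (vimage_algebra (space M) (\<lambda>\<omega>. \<lambda>t \<in> {0..} \<times> {0..}. N (fst t) (snd t) \<omega>)
          (\<Pi>\<^sub>M t \<in> {0..} \<times> {0..}. count_space UNIV)))
       (sets (vimage_algebra (space M) (\<lambda>\<omega>. \<lambda>j \<in> {1..}. Z j \<omega>)
          (\<Pi>\<^sub>M j \<in> {1..}. borel)))"

end

end

theory Submission
  imports Defs "HOL-Real_Asymp.Real_Asymp"
begin

text \<open>
  Conditioning on \<open>N(nt\<^sub>1, nt\<^sub>2)\<close>, which is Poisson with mean \<open>n\<^sup>2 t\<^sub>1 t\<^sub>2\<close>, and using that a sum of \<open>k\<close>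
  of the scaled variables has characteristic function \<open>(exp (- u\<^sup>2 / (2 n\<^sup>2)))\<^sup>k\<close>, one obtains the
  characteristic function \<open>exp (n\<^sup>2 t\<^sub>1 t\<^sub>2 (exp (- u\<^sup>2 / (2 n\<^sup>2)) - 1))\<close>. It tends to
  \<open>exp (- t\<^sub>1 t\<^sub>2 u\<^sup>2 / 2)\<close>, and Levy's continuity theorem concludes. On the axes, where the
  increments carry no information, both sides vanish almost surely.
\<close>

section \<open>Averaging at a random index, and independence\<close>

text \<open>The events \<open>N = k\<close> partition the space, so at each point a single term of
  the series survives. The \<open>k\<close>-th term has norm integral at most \<open>B\<close> times
  the probability of \<open>N = k\<close>, which is summable; this permits exchanging sum and
  integral. The value type is general because both real and complex instances are needed.\<close>

lemma (in prob_space) sums_expectation_random_index: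
  fixes f :: "nat \<Rightarrow> 'a \<Rightarrow> 'b::{banach, second_countable_topology}"
  assumes N [measurable]: "random_variable (count_space UNIV) N"
    and f [measurable]: "\<And>k. random_variable borel (f k)"
    and bound: "\<And>k \<omega>. norm (f k \<omega>) \<le> B"
  shows "(\<lambda>k. expectation (\<lambda>\<omega>. indicator {\<omega>. N \<omega> = k} \<omega> *\<^sub>R f k \<omega>)) sums
         expectation (\<lambda>\<omega>. f (N \<omega>) \<omega>)"
proof -
  let ?g = "\<lambda>k \<omega>. indicat_real {\<omega>. N \<omega> = k} \<omega> *\<^sub>R f k \<omega>"
  have supp: "?g k \<omega> = 0" if "k \<notin> {N \<omega>}" for k \<omega>
    using that by auto
  have int: "integrable M (?g k)" for k
    using bound by (intro integrable_const_bound[where B = B])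
      (auto split: split_indicator intro!: order_trans[OF norm_ge_zero bound])
  have pr: "summable (\<lambda>k. prob {\<omega> \<in> space M. N \<omega> = k})"
  proof -
    have "disjoint_family (\<lambda>k. {\<omega> \<in> space M. N \<omega> = k})"
      by (auto simp: disjoint_family_on_def)
    then have "(\<lambda>k. prob {\<omega> \<in> space M. N \<omega> = k}) sums prob (\<Union>k. {\<omega> \<in> space M. N \<omega> = k})"
      by (intro finite_measure_UNION image_subsetI) measurable
    then show ?thesis by (rule sums_summable)
  qed
  have le: "(\<integral>\<omega>. norm (?g k \<omega>) \<partial>M) \<le> B * prob {\<omega> \<in> space M. N \<omega> = k}" for k
  proof -
    have "(\<integral>\<omega>. norm (?g k \<omega>) \<partial>M) \<le> (\<integral>\<omega>. B * indicator {\<omega> \<in> space M. N \<omega> = k} \<omega> \<partial>M)"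
      using bound
      by (intro integral_mono integrable_norm int)
        (auto split: split_indicator simp: emeasure_eq_measure)
    then show ?thesis by simp
  qed
  have "(\<lambda>k. integral\<^sup>L M (?g k)) sums (\<integral>\<omega>. (\<Sum>k. ?g k \<omega>) \<partial>M)"
  proof (rule sums_integral[OF int])
    show "AE \<omega> in M. summable (\<lambda>k. norm (?g k \<omega>))"
    proof (rule AE_I2)
      show "summable (\<lambda>k. norm (?g k \<omega>))" for \<omega>
        by (rule summable_finite[of "{N \<omega>}"]) auto
    qed
    show "summable (\<lambda>k. \<integral>\<omega>. norm (?g k \<omega>) \<partial>M)"
      using le by (intro summable_comparison_test'[OF summable_mult[OF pr]]) auto
  qed
  moreover have "(\<Sum>k. ?g k \<omega>) = f (N \<omega>) \<omega>" for \<omega>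
    by (subst suminf_finite[of "{N \<omega>}"]) (use supp in auto)
  ultimately show ?thesis by simp
qed

text \<open>Conditioning on \<open>N\<close> without conditional expectations: on the right the
  inner expectation averages \<open>f k\<close> with the index frozen at
  \<open>k = N \<omega>\<close>. Both sides expand into series over \<open>k\<close>, and
  independence makes the series agree term by term.\<close>

lemma (in prob_space) expectation_random_index:
  fixes f :: "nat \<Rightarrow> 'a \<Rightarrow> complex"
  assumes N [measurable]: "random_variable (count_space UNIV) N"
    and f [measurable]: "\<And>k. random_variable borel (f k)"
    and bound: "\<And>k \<omega>. norm (f k \<omega>) \<le> B"
    and indep: "\<And>k. indep_var borel (indicator {\<omega>. N \<omega> = k}) borel (f k)"
  shows "expectation (\<lambda>\<omega>. f (N \<omega>) \<omega>) = expectation (\<lambda>\<omega>. expectation (f (N \<omega>)))"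
proof (rule sums_unique2)
  show "(\<lambda>k. expectation (\<lambda>\<omega>. indicator {\<omega>. N \<omega> = k} \<omega> *\<^sub>R f k \<omega>)) sums
        expectation (\<lambda>\<omega>. f (N \<omega>) \<omega>)"
    by (rule sums_expectation_random_index[OF N f bound])
  have int_f: "integrable M (f k)" for k
    using bound by (intro integrable_const_bound[where B = B]) auto
  have int_N: "integrable M (indicator {\<omega>. N \<omega> = k} :: 'a \<Rightarrow> complex)" for k
    by (intro integrable_const_bound[where B = 1]) (simp_all add: indicator_def)
  \<comment> \<open>This bound allows a second use of the series lemma, now with the constant
    functions \<open>expectation (f k)\<close> in place of \<open>f k\<close>.\<close>
  have "norm (expectation (f k)) \<le> B" for k
  proof -
    have "norm (expectation (f k)) \<le> expectation (\<lambda>\<omega>. norm (f k \<omega>))"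
      by simp
    also have "\<dots> \<le> B"
      using bound int_f by (intro integral_le_const) auto
    finally show ?thesis .
  qed
  then have "(\<lambda>k. expectation (\<lambda>\<omega>. indicator {\<omega>. N \<omega> = k} \<omega> *\<^sub>R expectation (f k))) sums
        expectation (\<lambda>\<omega>. expectation (f (N \<omega>)))"
    by (intro sums_expectation_random_index[OF N]) auto
  also have "(\<lambda>k. expectation (\<lambda>\<omega>. indicator {\<omega>. N \<omega> = k} \<omega> *\<^sub>R expectation (f k))) =
    (\<lambda>k. expectation (\<lambda>\<omega>. indicator {\<omega>. N \<omega> = k} \<omega> *\<^sub>R f k \<omega>))"
  proof
    fix k
    \<comment> \<open>The product rule for independent variables wants both factors of one type, so
      the indicator is complex here; it returns to a real scalar at the end.\<close>
    have "expectation (\<lambda>\<omega>. indicator {\<omega>. N \<omega> = k} \<omega> * f k \<omega>) =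
        expectation (indicator {\<omega>. N \<omega> = k}) * expectation (f k)"
      by (rule indep_var_lebesgue_integral[OF indep int_N int_f])
    also have "\<dots> = expectation (\<lambda>\<omega>. indicator {\<omega>. N \<omega> = k} \<omega> * expectation (f k))"
      by simp
    finally show "expectation (\<lambda>\<omega>. indicator {\<omega>. N \<omega> = k} \<omega> *\<^sub>R expectation (f k)) =
        expectation (\<lambda>\<omega>. indicator {\<omega>. N \<omega> = k} \<omega> *\<^sub>R f k \<omega>)"
      by (simp add: scaleR_conv_of_real of_real_indicator)
  qed
  finally show "(\<lambda>k. expectation (\<lambda>\<omega>. indicator {\<omega>. N \<omega> = k} \<omega> *\<^sub>R f k \<omega>)) sums
        expectation (\<lambda>\<omega>. expectation (f (N \<omega>)))" .
qed

text \<open>The sigma-algebras generated by \<open>X\<close> and \<open>Y\<close> lie inside those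
  of \<open>A\<close> and \<open>B\<close>, and independence passes to subfamilies. \<open>A\<close>
  and \<open>B\<close> serve only as carriers of sigma-algebras; this links
  \<open>field_indep_of_seq\<close> to \<open>indep_var\<close>.\<close>

lemma (in prob_space) indep_var_of_indep_set:
  assumes indep: "indep_set (sets A) (sets B)"
    and [simp]: "space A = space M" "space B = space M"
    and X: "X \<in> A \<rightarrow>\<^sub>M S" and Y: "Y \<in> B \<rightarrow>\<^sub>M T"
  shows "indep_var S X T Y"
proof -
  \<comment> \<open>Independence of set families includes that their members are events, so
    measurability over \<open>A\<close> or \<open>B\<close> gives measurability over
    \<open>M\<close>.\<close>
  have AB: "sets A \<subseteq> events" "sets B \<subseteq> events"
    using indep by (auto simp: indep_set_def indep_sets_def split: bool.splits)
  have rv: "random_variable S X" "random_variable T Y"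
    using measurable_mono[OF order_refl refl, of A M S] measurable_mono[OF order_refl refl, of B M T]
      AB X Y by auto
  have "{X -` C \<inter> space M |C. C \<in> sets S} \<subseteq> sets A"
    using measurable_sets[OF X] by auto
  from sets.sigma_sets_subset[OF this]
  have "sigma_sets (space M) {X -` C \<inter> space M |C. C \<in> sets S} \<subseteq> sets A"
    by simp
  moreover have "{Y -` C \<inter> space M |C. C \<in> sets T} \<subseteq> sets B"
    using measurable_sets[OF Y] by auto
  from sets.sigma_sets_subset[OF this]
  have "sigma_sets (space M) {Y -` C \<inter> space M |C. C \<in> sets T} \<subseteq> sets B"
    by simp
  ultimately have "indep_set (sigma_sets (space M) {X -` C \<inter> space M |C. C \<in> sets S})
      (sigma_sets (space M) {Y -` C \<inter> space M |C. C \<in> sets T})"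
    using indep unfolding indep_set_def
    by (elim indep_sets_mono_sets) (auto split: bool.split)
  with rv show ?thesis
    by (simp add: indep_var_eq)
qed

section \<open>Transforms of Poisson and normal laws\<close>

text \<open>The factor \<open>exp (c * k)\<close> merges with \<open>rate ^ k\<close> into
  \<open>(rate * exp c) ^ k\<close>, leaving an exponential series. The sign of \<open>c\<close>
  keeps the integrand bounded by 1, as the series lemma requires.\<close>

lemma expectation_exp_poisson_pmf:
  fixes c rate :: real
  assumes "0 < rate" "c \<le> 0"
  shows "(\<integral>k. exp (c * real k) \<partial>measure_pmf (poisson_pmf rate)) = exp (rate * (exp c - 1))"
proof (rule sums_unique2)
  let ?P = "measure_pmf (poisson_pmf rate)"
  \<comment> \<open>With \<open>id\<close> as the random index and deterministic summands, the
    series lemma decomposes the integral over the atoms of the Poisson law.\<close>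
  have "(\<lambda>k. \<integral>j. indicat_real {j. id j = k} j *\<^sub>R exp (c * real k) \<partial>?P) sums
      (\<integral>j. exp (c * real (id j)) \<partial>?P)"
    using assms by (intro measure_pmf.sums_expectation_random_index[where B = 1])
      (auto simp: mult_nonpos_nonneg)
  moreover have "(\<integral>j. indicat_real {j. id j = k} j *\<^sub>R exp (c * real k) \<partial>?P) =
      exp (- rate) * ((rate * exp c) ^ k /\<^sub>R fact k)" for k
    using assms by (simp add: measure_pmf_single power_mult_distrib field_simps
      flip: exp_of_nat_mult)
  ultimately show "(\<lambda>k. exp (- rate) * ((rate * exp c) ^ k /\<^sub>R fact k)) sums
      (\<integral>k. exp (c * real k) \<partial>?P)"
    by simp
  have "(\<lambda>k. exp (- rate) * ((rate * exp c) ^ k /\<^sub>R fact k)) sums (exp (- rate) * exp (rate * exp c))"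
    by (intro sums_mult exp_converges)
  then show "(\<lambda>k. exp (- rate) * ((rate * exp c) ^ k /\<^sub>R fact k)) sums exp (rate * (exp c - 1))"
    by (simp add: algebra_simps flip: exp_add)
qed

text \<open>Evaluating the characteristic function of the standardised \<open>X / \<sigma>\<close>
  at \<open>\<sigma> * u\<close> gives that of \<open>X\<close> at \<open>u\<close>.\<close>

lemma (in prob_space) char_distr_normal:
  assumes X: "distributed M lborel X (normal_density 0 \<sigma>)" and "0 < \<sigma>"
  shows "char (distr M borel X) u = exp (- (\<sigma> * u)\<^sup>2 / 2)"
proof -
  have [measurable]: "random_variable borel X"
    using distributed_measurable[OF X] by simp
  have "distributed M lborel (\<lambda>\<omega>. X \<omega> / \<sigma>) std_normal_density"
    using X normal_standard_normal_convert[OF \<open>0 < \<sigma>\<close>, of X 0] by simp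
  then have "distr M lborel (\<lambda>\<omega>. X \<omega> / \<sigma>) = std_normal_distribution"
    by (rule distributed_distr_eq_density)
  \<comment> \<open>\<open>lborel\<close> and \<open>borel\<close> have the same measurable sets,
    and only these matter for the target of \<open>distr\<close>.\<close>
  then have "distr M borel (\<lambda>\<omega>. X \<omega> / \<sigma>) = std_normal_distribution"
    by (simp cong: distr_cong)
  then have "char (distr M borel (\<lambda>\<omega>. X \<omega> / \<sigma>)) (\<sigma> * u) = exp (- (\<sigma> * u)\<^sup>2 / 2)"
    by (simp add: char_std_normal_distribution)
  then show ?thesis
    using \<open>0 < \<sigma>\<close> by (simp add: char_def integral_distr)
qed

lemma (in prob_space) char_distr_cong_AE:
  assumes "random_variable borel X" "random_variable borel Y" "AE \<omega> in M. X \<omega> = Y \<omega>"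
  shows "char (distr M borel X) = char (distr M borel Y)"
proof -
  have "distr M borel X = distr M borel Y"
    using assms by (intro distr_cong_AE) auto
  then show ?thesis by simp
qed

section \<open>One-point laws of the two fields\<close>

text \<open>Off the axes, \<open>W\<close> at a point is almost surely its increment over the
  rectangle spanned with the origin, which is normal with variance
  \<open>t\<^sub>1 * t\<^sub>2\<close>. On an axis that rectangle is empty, hence not in
  \<open>rectangles\<close>, and the vanishing of \<open>W\<close> is used instead.\<close>

lemma (in prob_space) char_brownian_sheet:
  assumes W: "brownian_sheet W" and t: "0 \<le> t\<^sub>1" "0 \<le> t\<^sub>2"
  shows "char (distr M borel (W t\<^sub>1 t\<^sub>2)) u = exp (- (t\<^sub>1 * t\<^sub>2 * u\<^sup>2) / 2)"
proof -
  have [measurable]: "random_variable borel (W s\<^sub>1 s\<^sub>2)" if "0 \<le> s\<^sub>1" "0 \<le> s\<^sub>2" for s\<^sub>1 s\<^sub>2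
    using W that by (auto simp: brownian_sheet_def)
  have axes: "AE \<omega> in M. W 0 s \<omega> = 0" "AE \<omega> in M. W s 0 \<omega> = 0" if "0 \<le> s" for s
    using W that by (auto simp: brownian_sheet_def)
  show ?thesis
  proof (cases "t\<^sub>1 = 0 \<or> t\<^sub>2 = 0")
    case True
    then have "AE \<omega> in M. W t\<^sub>1 t\<^sub>2 \<omega> = 0"
      using axes t by auto
    then have "char (distr M borel (W t\<^sub>1 t\<^sub>2)) = char (distr M borel (\<lambda>_. 0))"
      using t by (intro char_distr_cong_AE) auto
    then show ?thesis
      using True by (auto simp: char_def integral_distr prob_space simp del: distr_const)
  next
    case False
    let ?I = "rect_increment W (0, t\<^sub>1, 0, t\<^sub>2)"
    have "(0, t\<^sub>1, 0, t\<^sub>2) \<in> rectangles"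
      using t False by (auto simp: rectangles_def)
    then have I: "distributed M lborel ?I (normal_density 0 (sqrt (t\<^sub>1 * t\<^sub>2)))"
      using W by (fastforce simp: brownian_sheet_def)
    \<comment> \<open>The other three corners \<open>(0, t\<^sub>2)\<close>,
      \<open>(t\<^sub>1, 0)\<close> and \<open>(0, 0)\<close> lie on the axes.\<close>
    have "AE \<omega> in M. W t\<^sub>1 t\<^sub>2 \<omega> = ?I \<omega>"
      using axes(1)[OF t(2)] axes(2)[OF t(1)] axes(1)[of 0] by auto
    then have "char (distr M borel (W t\<^sub>1 t\<^sub>2)) = char (distr M borel ?I)"
      using t distributed_measurable[OF I] by (intro char_distr_cong_AE) auto
    then show ?thesis
      using char_distr_normal[OF I, of u] t False by (simp add: power_mult_distrib)
  qed
qed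

text \<open>The same reduction to the rectangle at the origin, now with the Poisson law, covers the
  axes as well: there both sides equal 1.\<close>

lemma (in prob_space) expectation_exp_poisson_random_field:
  assumes N: "poisson_random_field rate N" and s: "0 \<le> s\<^sub>1" "0 \<le> s\<^sub>2" and c: "c \<le> 0"
  shows "expectation (\<lambda>\<omega>. exp (c * real (N s\<^sub>1 s\<^sub>2 \<omega>))) = exp (rate * (s\<^sub>1 * s\<^sub>2) * (exp c - 1))"
proof -
  have [measurable]: "random_variable (count_space UNIV) (N r\<^sub>1 r\<^sub>2)" if "0 \<le> r\<^sub>1" "0 \<le> r\<^sub>2" for r\<^sub>1 r\<^sub>2
    using N that by (auto simp: poisson_random_field_def)
  have real_N: "random_variable borel (\<lambda>\<omega>. real (N r\<^sub>1 r\<^sub>2 \<omega>))" if "0 \<le> r\<^sub>1" "0 \<le> r\<^sub>2" for r\<^sub>1 r\<^sub>2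
    using that by measurable
  have axes: "AE \<omega> in M. N 0 r \<omega> = 0" "AE \<omega> in M. N r 0 \<omega> = 0" if "0 \<le> r" for r
    using N that by (auto simp: poisson_random_field_def)
  have Ns [measurable]: "random_variable (count_space UNIV) (N s\<^sub>1 s\<^sub>2)"
    using s by simp
  show ?thesis
  proof (cases "s\<^sub>1 = 0 \<or> s\<^sub>2 = 0")
    case True
    then have "AE \<omega> in M. N s\<^sub>1 s\<^sub>2 \<omega> = 0"
      using axes s by auto
    then have "expectation (\<lambda>\<omega>. exp (c * real (N s\<^sub>1 s\<^sub>2 \<omega>))) = expectation (\<lambda>\<omega>. 1)"
      by (intro integral_cong_AE) auto
    then show ?thesis
      using True by (auto simp: prob_space)
  next
    case False
    let ?I = "rect_increment (\<lambda>t\<^sub>1 t\<^sub>2 \<omega>. real (N t\<^sub>1 t\<^sub>2 \<omega>)) (0, s\<^sub>1, 0, s\<^sub>2)"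
    have "random_variable borel (\<lambda>\<omega>. real (N s\<^sub>1 s\<^sub>2 \<omega>) - real (N 0 s\<^sub>2 \<omega>) - real (N s\<^sub>1 0 \<omega>) + real (N 0 0 \<omega>))"
      using s by (intro borel_measurable_add borel_measurable_diff real_N) auto
    moreover have "?I = (\<lambda>\<omega>. real (N s\<^sub>1 s\<^sub>2 \<omega>) - real (N 0 s\<^sub>2 \<omega>) - real (N s\<^sub>1 0 \<omega>) + real (N 0 0 \<omega>))"
      by (rule ext) simp
    ultimately have I [measurable]: "random_variable borel ?I"
      by simp
    have "(0, s\<^sub>1, 0, s\<^sub>2) \<in> rectangles"
      using s False by (auto simp: rectangles_def)
    then have distr: "distr M borel ?I =
        distr (measure_pmf (poisson_pmf (rate * (s\<^sub>1 * s\<^sub>2)))) borel real"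
      using N by (fastforce simp: poisson_random_field_def)
    have "0 < rate * (s\<^sub>1 * s\<^sub>2)"
      using N s False by (auto simp: poisson_random_field_def)
    have "AE \<omega> in M. real (N s\<^sub>1 s\<^sub>2 \<omega>) = ?I \<omega>"
      using axes(1)[OF s(2)] axes(2)[OF s(1)] axes(1)[of 0] by auto
    \<comment> \<open>\<open>rect_increment\<close> stays folded from here on, so that the equation
      \<open>distr\<close> still applies.\<close>
    then have "expectation (\<lambda>\<omega>. exp (c * real (N s\<^sub>1 s\<^sub>2 \<omega>))) = expectation (\<lambda>\<omega>. exp (c * ?I \<omega>))"
      by (intro integral_cong_AE) (auto simp del: rect_increment.simps)
    also have "\<dots> = (\<integral>x. exp (c * x) \<partial>distr M borel ?I)"
      by (simp add: integral_distr del: rect_increment.simps)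
    also have "\<dots> = (\<integral>k. exp (c * real k) \<partial>measure_pmf (poisson_pmf (rate * (s\<^sub>1 * s\<^sub>2))))"
      unfolding distr by (simp add: integral_distr)
    also have "\<dots> = exp (rate * (s\<^sub>1 * s\<^sub>2) * (exp c - 1))"
      by (rule expectation_exp_poisson_pmf[OF \<open>0 < rate * (s\<^sub>1 * s\<^sub>2)\<close> c])
    finally show ?thesis .
  qed
qed

section \<open>The compound Poisson sum\<close>

text \<open>One side reads a single coordinate of the whole field, the other finitely many
  coordinates of the whole sequence, so each is measurable for its generated sigma-algebra. The maps
  \<open>g\<close> and \<open>h\<close> bring both into a common type, as \<open>indep_var\<close>
  demands.\<close>

lemma (in prob_space) indep_var_field_partial_sum:
  fixes g :: "nat \<Rightarrow> 'c::topological_space" and h :: "real \<Rightarrow> 'c"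
  assumes "field_indep_of_seq N Z" and s: "0 \<le> s\<^sub>1" "0 \<le> s\<^sub>2"
    and h [measurable]: "h \<in> borel_measurable borel"
  shows "indep_var borel (\<lambda>\<omega>. g (N s\<^sub>1 s\<^sub>2 \<omega>)) borel (\<lambda>\<omega>. h (\<Sum>j = 1..k. Z j \<omega>))"
proof (rule indep_var_of_indep_set)
  let ?PN = "\<Pi>\<^sub>M t \<in> {0..} \<times> {0..}. count_space (UNIV :: nat set)"
  let ?PZ = "\<Pi>\<^sub>M j \<in> {1..}. (borel :: real measure)"
  let ?N = "\<lambda>\<omega>. \<lambda>t \<in> {0::real..} \<times> {0::real..}. N (fst t) (snd t) \<omega>"
  let ?Z = "\<lambda>\<omega>. \<lambda>j \<in> {1..}. Z j \<omega>"
  let ?A = "vimage_algebra (space M) ?N ?PN" and ?B = "vimage_algebra (space M) ?Z ?PZ"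
  show "indep_set (sets ?A) (sets ?B)"
    using assms(1) by (simp add: field_indep_of_seq_def)
  show "space ?A = space M" "space ?B = space M"
    by simp_all
  have NA: "?N \<in> ?A \<rightarrow>\<^sub>M ?PN"
    by (rule measurable_vimage_algebra1) (auto simp: space_PiM)
  have [measurable]: "N s\<^sub>1 s\<^sub>2 \<in> ?A \<rightarrow>\<^sub>M count_space UNIV"
    using measurable_compose[OF NA measurable_component_singleton[of "(s\<^sub>1, s\<^sub>2)"]] s by simp
  show "(\<lambda>\<omega>. g (N s\<^sub>1 s\<^sub>2 \<omega>)) \<in> ?A \<rightarrow>\<^sub>M borel"
    by measurable
  have Z: "?Z \<in> ?B \<rightarrow>\<^sub>M ?PZ"
    by (rule measurable_vimage_algebra1) (auto simp: space_PiM)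
  have "Z j \<in> borel_measurable ?B" if "j \<in> {1..k}" for j
    using measurable_compose[OF Z measurable_component_singleton[of j]] that by simp
  then have "(\<lambda>\<omega>. \<Sum>j = 1..k. Z j \<omega>) \<in> borel_measurable ?B"
    by (rule borel_measurable_sum)
  then show "(\<lambda>\<omega>. h (\<Sum>j = 1..k. Z j \<omega>)) \<in> ?B \<rightarrow>\<^sub>M borel"
    by measurable
qed

text \<open>Given \<open>N = k\<close>, the scaled sum has characteristic function
  \<open>exp (c * k)\<close> with \<open>c\<close> as in the proof; averaging over the Poisson index
  gives the formula. The scale \<open>a\<close> later becomes \<open>1 / n\<close>.\<close>

lemma (in prob_space) char_compound_poisson_field:
  assumes N: "poisson_random_field rate N"
    and Z: "indep_vars (\<lambda>_. borel) Z {1..}"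
    and std: "\<And>j. 1 \<le> j \<Longrightarrow> distributed M lborel (Z j) std_normal_density"
    and NZ: "field_indep_of_seq N Z"
    and s: "0 \<le> s\<^sub>1" "0 \<le> s\<^sub>2"
  shows "random_variable borel (\<lambda>\<omega>. \<Sum>j = 1..N s\<^sub>1 s\<^sub>2 \<omega>. Z j \<omega>)"
    and "char (distr M borel (\<lambda>\<omega>. a * (\<Sum>j = 1..N s\<^sub>1 s\<^sub>2 \<omega>. Z j \<omega>))) u =
         exp (rate * (s\<^sub>1 * s\<^sub>2) * (exp (- (a * u)\<^sup>2 / 2) - 1))"
proof -
  have Ns [measurable]: "random_variable (count_space UNIV) (N s\<^sub>1 s\<^sub>2)"
    using N s by (auto simp: poisson_random_field_def)
  have "random_variable borel (Z j)" if "j \<in> {1..k}" for j k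
    using distributed_measurable[OF std] that by simp
  then have S [measurable]: "random_variable borel (\<lambda>\<omega>. \<Sum>j = 1..k. Z j \<omega>)" for k
    by (rule borel_measurable_sum)
  show SN [measurable]: "random_variable borel (\<lambda>\<omega>. \<Sum>j = 1..N s\<^sub>1 s\<^sub>2 \<omega>. Z j \<omega>)"
    \<comment> \<open>The index takes countably many values, and for each fixed value the partial
      sum is measurable.\<close>
    by (rule measurable_compose_countable[OF S Ns])
  \<comment> \<open>The logarithm of the characteristic function of \<open>a * Z j\<close> at
    \<open>u\<close>; it is nonpositive, as the Poisson transform requires.\<close>
  define c where "c = - (a * u)\<^sup>2 / 2"
  define f where "f k \<omega> = iexp (u * (a * (\<Sum>j = 1..k. Z j \<omega>)))" for k \<omega>
  have charZ: "char (distr M borel (Z j)) v = exp (- v\<^sup>2 / 2)" if "1 \<le> j" for j v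
    using char_distr_normal[OF std[OF that], of v] by simp
  have Ef: "expectation (f k) = exp (c * real k)" for k
  proof -
    have "expectation (f k) = char (distr M borel (\<lambda>\<omega>. \<Sum>j = 1..k. Z j \<omega>)) (a * u)"
      by (simp add: char_def integral_distr f_def[abs_def] mult_ac del: One_nat_def)
    also have "\<dots> = (\<Prod>j = 1..k. char (distr M borel (Z j)) (a * u))"
      by (intro char_distr_sum indep_vars_subset[OF Z]) auto
    also have "\<dots> = complex_of_real (exp c) ^ k"
      by (simp add: charZ c_def)
    finally show ?thesis
      by (simp add: mult.commute flip: exp_of_nat_mult of_real_power)
  qed
  have "char (distr M borel (\<lambda>\<omega>. a * (\<Sum>j = 1..N s\<^sub>1 s\<^sub>2 \<omega>. Z j \<omega>))) u =
      expectation (\<lambda>\<omega>. f (N s\<^sub>1 s\<^sub>2 \<omega>) \<omega>)"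
    by (simp add: char_def integral_distr f_def del: One_nat_def)
  also have "\<dots> = expectation (\<lambda>\<omega>. expectation (f (N s\<^sub>1 s\<^sub>2 \<omega>)))"
  proof (rule expectation_random_index[OF Ns])
    show "random_variable borel (f k)" for k
      unfolding f_def by measurable
    show "cmod (f k \<omega>) \<le> 1" for k \<omega>
      by (simp add: f_def)
    \<comment> \<open>The event \<open>N = k\<close> is expressed as a function of the field value,
      with \<open>g = indicator {k}\<close> and \<open>h\<close> the complex exponential.\<close>
    have "indep_var borel (\<lambda>\<omega>. indicator {k} (N s\<^sub>1 s\<^sub>2 \<omega>) :: complex) borel
        (\<lambda>\<omega>. iexp (u * (a * (\<Sum>j = 1..k. Z j \<omega>))))" for k
      by (rule indep_var_field_partial_sum[OF NZ s]) measurable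
    then show "indep_var borel (indicator {\<omega>. N s\<^sub>1 s\<^sub>2 \<omega> = k}) borel (f k)" for k
      by (simp add: f_def[abs_def] indicator_def[abs_def])
  qed
  also have "\<dots> = complex_of_real (expectation (\<lambda>\<omega>. exp (c * real (N s\<^sub>1 s\<^sub>2 \<omega>))))"
    by (simp add: Ef)
  also have "\<dots> = exp (rate * (s\<^sub>1 * s\<^sub>2) * (exp c - 1))"
    by (subst expectation_exp_poisson_random_field[OF N s]) (auto simp: c_def)
  finally show "char (distr M borel (\<lambda>\<omega>. a * (\<Sum>j = 1..N s\<^sub>1 s\<^sub>2 \<omega>. Z j \<omega>))) u =
      exp (rate * (s\<^sub>1 * s\<^sub>2) * (exp (- (a * u)\<^sup>2 / 2) - 1))"
    by (simp add: c_def)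
qed

section \<open>Passage to the limit\<close>

theorem mainTheorem9:
  fixes M :: "'a measure" and M' :: "'b measure"
    and N :: "real \<Rightarrow> real \<Rightarrow> 'a \<Rightarrow> nat"
    and Z :: "nat \<Rightarrow> 'a \<Rightarrow> real"
    and W :: "real \<Rightarrow> real \<Rightarrow> 'b \<Rightarrow> real"
    and t\<^sub>1 t\<^sub>2 :: real
  assumes "prob_space M" and "prob_space M'"
    and "prob_space.poisson_random_field M 1 N"
    and "prob_space.indep_vars M (\<lambda>_. borel) Z {1..}"
    and "\<And>j. j \<ge> 1 \<Longrightarrow> distributed M lborel (Z j) std_normal_density"
    and "prob_space.field_indep_of_seq M N Z"
    and "prob_space.brownian_sheet M' W"
    and "t\<^sub>1 \<ge> 0" and "t\<^sub>2 \<ge> 0"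
  shows "weak_conv_m
           (\<lambda>n. distr M borel
             (\<lambda>\<omega>. 1 / real n * (\<Sum>j = 1..N (real n * t\<^sub>1) (real n * t\<^sub>2) \<omega>. Z j \<omega>)))
           (distr M' borel (W t\<^sub>1 t\<^sub>2))"
proof -
  interpret M: prob_space M by fact
  interpret M': prob_space M' by fact
  let ?S = "\<lambda>n \<omega>. \<Sum>j = 1..N (real n * t\<^sub>1) (real n * t\<^sub>2) \<omega>. Z j \<omega>"
  have nt: "0 \<le> real n * t\<^sub>1" "0 \<le> real n * t\<^sub>2" for n
    using assms(8,9) by auto
  have S: "M.random_variable borel (?S n)"
    and char_S: "char (distr M borel (\<lambda>\<omega>. a * ?S n \<omega>)) u =
      exp (1 * (real n * t\<^sub>1 * (real n * t\<^sub>2)) * (exp (- (a * u)\<^sup>2 / 2) - 1))" for n a u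
    by (rule M.char_compound_poisson_field[OF assms(3,4) _ assms(6) nt]; use assms(5) in simp)+
  have W: "M'.random_variable borel (W t\<^sub>1 t\<^sub>2)"
    using assms(7-9) by (auto simp: M'.brownian_sheet_def)
  show ?thesis
  proof (rule levy_continuity)
    show "real_distribution (distr M borel (\<lambda>\<omega>. 1 / real n * ?S n \<omega>))" for n
      by (intro M.real_distribution_distr borel_measurable_times S) auto
    show "real_distribution (distr M' borel (W t\<^sub>1 t\<^sub>2))"
      using W by simp
    fix u :: real
    \<comment> \<open>With \<open>a = 1 / n\<close>, the exponent of the characteristic function is
      \<open>t\<^sub>1 * t\<^sub>2\<close> times \<open>n^2 * (exp (- b / n^2) - 1)\<close>, which
      tends to \<open>- b\<close> by first-order expansion of the exponential.\<close>
    define b where "b = u\<^sup>2 / 2"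
    have "(\<lambda>n. exp (t\<^sub>1 * t\<^sub>2 * ((real n)\<^sup>2 * (exp (- b / (real n)\<^sup>2) - 1)))) \<longlonglongrightarrow> exp (t\<^sub>1 * t\<^sub>2 * - b)"
      by (intro tendsto_intros) real_asymp
    then have "(\<lambda>n. complex_of_real (exp (t\<^sub>1 * t\<^sub>2 * ((real n)\<^sup>2 * (exp (- b / (real n)\<^sup>2) - 1)))))
        \<longlonglongrightarrow> exp (t\<^sub>1 * t\<^sub>2 * - b)"
      by (rule tendsto_of_real)
    also have "complex_of_real (exp (t\<^sub>1 * t\<^sub>2 * - b)) = char (distr M' borel (W t\<^sub>1 t\<^sub>2)) u"
      using M'.char_brownian_sheet[OF assms(7-9), of u] by (simp add: b_def)
    \<comment> \<open>The equality includes \<open>n = 0\<close>: there \<open>1 / real n\<close> is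
      0 by convention and both sides are 1.\<close>
    also have "(\<lambda>n. complex_of_real (exp (t\<^sub>1 * t\<^sub>2 * ((real n)\<^sup>2 * (exp (- b / (real n)\<^sup>2) - 1))))) =
        (\<lambda>n. char (distr M borel (\<lambda>\<omega>. 1 / real n * ?S n \<omega>)) u)"
      unfolding char_S by (simp add: b_def power2_eq_square algebra_simps)
    finally show "(\<lambda>n. char (distr M borel (\<lambda>\<omega>. 1 / real n * ?S n \<omega>)) u)
        \<longlonglongrightarrow> char (distr M' borel (W t\<^sub>1 t\<^sub>2)) u" .
  qed
qed

end
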